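(* For every integer $d\ge 2$, there exists a positive constant $c_d$ with the following property. For every positive integer $m$, any $m$-fold covering of $\mathbb{R}^d$ with open unit balls can be split into two coverings, provided that no point of the space belongs to more than $c_d2^{m/d}$ balls of the covering.
   Context: A unit ball is a Euclidean ball of radius $1$. A family $\mathcal{C}$ of subsets of $\mathbb{R}^d$ is an $m$-fold covering of $\mathbb{R}^d$ if every point of $\mathbb{R}^d$ belongs to at least $m$ members of $\mathcal{C}$; a $1$-fold covering is called a covering. An $m$-fold covering $\mathcal{C}$ can be split into two coverings if $\mathcal{C}$ can be partitioned into two subfamilies, each of which is a covering of $\mathbb{R}^d$. *)

theory Defs
  imports "HOL-Analysis.Analysis"
begin

text \<open>
  Since \<open>card\<close> of an infinite set is \<open>0\<close>, the infinite case is treated separately: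
  infinitely many members count as at least \<open>m\<close>, and never as at most \<open>b\<close>.
\<close>

definition fold_covering :: "nat \<Rightarrow> 'a set set \<Rightarrow> bool" where
  "fold_covering m \<C> \<longleftrightarrow>
     (\<forall>x. infinite {B \<in> \<C>. x \<in> B} \<or> m \<le> card {B \<in> \<C>. x \<in> B})"

definition covered_at_most :: "real \<Rightarrow> 'a set set \<Rightarrow> bool" where
  "covered_at_most b \<C> \<longleftrightarrow>
     (\<forall>x. finite {B \<in> \<C>. x \<in> B} \<and> real (card {B \<in> \<C>. x \<in> B}) \<le> b)"

abbreviation covering :: "'a set set \<Rightarrow> bool" where
  "covering \<equiv> fold_covering 1"

definition splits_into_two_coverings :: "'a set set \<Rightarrow> bool" where
  "splits_into_two_coverings \<C> \<longleftrightarrow>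
     (\<exists>\<A> \<B>. \<A> \<union> \<B> = \<C> \<and> \<A> \<inter> \<B> = {} \<and> covering \<A> \<and> covering \<B>)"

definition open_unit_balls :: "'a::metric_space set set" where
  "open_unit_balls = range (\<lambda>x. ball x 1)"

end

theory Submission
  imports Defs
begin

text \<open>
  Give each ball independently one of two colours. A point in at least \<open>m\<close> balls sees only one
  colour with probability at most \<open>2\<^sup>1\<^sup>-\<^sup>m\<close>, so by the Lovasz local lemma some colouring works
  provided that each of these events depends on at most \<open>2\<^sup>m / 8\<close> others. What is needed is thus a
  bound of order \<open>M\<^sup>d\<close>, where \<open>M\<close> is the maximal multiplicity, on the number of events that
  share a ball with a given one.

  All points with the same set of centres at distance less than 1 give the same event, and the
  number of these sets could be bounded by counting the cells of an arrangement of spheres. It is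
  easier to keep only the events of the \<^emph>\<open>vertices\<close>: the points \<open>y\<close> whose directions to the centres
  at distance exactly 1 span the space. This loses nothing, because the set of centres of any point
  contains that of a vertex (\<open>near_contains_near_vertex\<close>). Since \<open>d\<close> of those directions already
  span, and \<open>d\<close> spheres with spanning directions meet in at most two points
  (\<open>sphere_intersection_le_2\<close>), \<open>N\<close> centres have at most \<open>2 N\<^sup>d\<close> vertices (\<open>card_vertices_le\<close>).

  Two events that share a ball belong to vertices less than 2 apart, and all centres that determine
  the second vertex lie within distance 3 of the first. A ball of radius 3 is covered by a number
  \<open>k\<close> of unit balls that depends only on \<open>d\<close>, so it holds at most \<open>N = k M\<close> centres
  (\<open>card_cball_3_le\<close>). The local lemma applies as soon as \<open>16 (k M)\<^sup>d \<le> 2\<^sup>m\<close>, for which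
  \<open>M \<le> 2\<^sup>m\<^sup>/\<^sup>d / (16 k)\<close> suffices.

  The local lemma is proved by counting colourings of finite hypergraphs, and compactness extends it
  to infinite ones (\<open>hypergraph_two_colourable\<close>).
\<close>

section \<open>Two-colouring sparse hypergraphs\<close>

text \<open>A colouring is represented by the set \<open>A\<close> of the points that have the first colour.\<close>

definition bichromatic :: "'a set \<Rightarrow> 'a set \<Rightarrow> bool" where
  "bichromatic A e \<longleftrightarrow> e \<inter> A \<noteq> {} \<and> \<not> e \<subseteq> A"

definition colourings :: "'a set \<Rightarrow> 'a set set \<Rightarrow> 'a set set" where
  "colourings W F = {A. A \<subseteq> W \<and> (\<forall>f\<in>F. bichromatic A f)}"

lemma finite_colourings: "finite W \<Longrightarrow> finite (colourings W F)"
  by (rule finite_subset[of _ "Pow W"]) (auto simp: colourings_def)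

text \<open>
  Independence in counting form: the edges in \<open>F\<close> constrain only the colours outside \<open>e\<close>, so each
  admissible colouring of the outside extends to \<open>e\<close> in \<open>2\<^bsup>card e\<^esup>\<close> ways, of which two are
  monochromatic.
\<close>

lemma monochromatic_independent:
  assumes "finite W" "e \<subseteq> W" "e \<noteq> {}" and disj: "\<And>f. f \<in> F \<Longrightarrow> f \<inter> e = {}"
  shows "2 ^ card e * card {A \<in> colourings W F. \<not> bichromatic A e} = 2 * card (colourings W F)"
proof -
  define R where "R = colourings (W - e) F"
  define glue where "glue = (\<lambda>(X, B). X \<union> B :: 'a set)"
  have R: "B \<subseteq> W - e" if "B \<in> R" for B
    using that by (auto simp: R_def colourings_def)
  have bi: "bichromatic A f \<longleftrightarrow> bichromatic (A - e) f" if "f \<in> F" for A f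
    using disj[OF that] by (auto simp: bichromatic_def)
  have restrict: "A - e \<in> R" if "A \<in> colourings W F" for A
    using that by (auto simp: R_def colourings_def simp flip: bi)
  have extend: "X \<union> B \<in> colourings W F" if "X \<subseteq> e" "B \<in> R" for X B
  proof -
    have "(X \<union> B) - e = B" using that R by auto
    then have "bichromatic (X \<union> B) f" if "f \<in> F" for f
      using bi[OF that, of "X \<union> B"] that \<open>B \<in> R\<close> by (simp add: R_def colourings_def)
    then show ?thesis
      using that R \<open>e \<subseteq> W\<close> by (auto simp: colourings_def)
  qed
  have inj: "inj_on glue (Pow e \<times> R)"
  proof (rule inj_onI, clarify)
    fix X B X' B'
    assume *: "X \<subseteq> e" "B \<in> R" "X' \<subseteq> e" "B' \<in> R" "glue (X, B) = glue (X', B')"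
    then have "X \<union> B = X' \<union> B'" by (simp add: glue_def)
    with * R[of B] R[of B'] show "X = X' \<and> B = B'" by blast
  qed
  have all: "colourings W F = glue ` (Pow e \<times> R)"
  proof (intro equalityI subsetI)
    fix A assume "A \<in> colourings W F"
    then have "(A \<inter> e, A - e) \<in> Pow e \<times> R" "A = glue (A \<inter> e, A - e)"
      using restrict by (auto simp: glue_def)
    then show "A \<in> glue ` (Pow e \<times> R)" by blast
  qed (auto simp: glue_def extend)
  have mono: "{A \<in> colourings W F. \<not> bichromatic A e} = glue ` ({{}, e} \<times> R)"
  proof (intro equalityI subsetI)
    fix A assume "A \<in> {A \<in> colourings W F. \<not> bichromatic A e}"
    then have "(A \<inter> e, A - e) \<in> {{}, e} \<times> R" "A = glue (A \<inter> e, A - e)"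
      using restrict by (auto simp: glue_def bichromatic_def)
    then show "A \<in> glue ` ({{}, e} \<times> R)" by blast
  next
    fix A assume "A \<in> glue ` ({{}, e} \<times> R)"
    then obtain X B where "X = {} \<or> X = e" "B \<in> R" "A = X \<union> B"
      by (auto simp: glue_def)
    then show "A \<in> {A \<in> colourings W F. \<not> bichromatic A e}"
      using extend[of X B] R[of B] by (auto simp: bichromatic_def)
  qed
  have "finite e" using assms finite_subset by blast
  have "card (colourings W F) = 2 ^ card e * card R"
    using \<open>finite e\<close> by (simp add: all card_image[OF inj] card_cartesian_product card_Pow)
  moreover have "card {A \<in> colourings W F. \<not> bichromatic A e} = 2 * card R"
  proof -
    have "inj_on glue ({{}, e} \<times> R)" by (rule inj_on_subset[OF inj]) auto
    then show ?thesis using \<open>e \<noteq> {}\<close> by (simp add: mono card_image card_cartesian_product)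
  qed
  ultimately show ?thesis by simp
qed

text \<open>
  The inductive core of the local lemma: conditioning on the edges in \<open>F\<close> being bichromatic at
  most doubles the bound \<open>2 / 2\<^sup>m\<close> on the probability that \<open>e\<close> is monochromatic. Dropping the
  edges of \<open>F\<close> that meet \<open>e\<close> makes the event independent of the condition; by induction each of
  the at most \<open>2\<^sup>m / 8\<close> dropped edges excludes at most a fraction \<open>4 / 2\<^sup>m\<close> of the remaining
  colourings, so restoring them loses at most half.
\<close>

lemma monochromatic_conditional:
  assumes W: "finite W" and E: "\<And>e. e \<in> E \<Longrightarrow> e \<subseteq> W" "\<And>e. e \<in> E \<Longrightarrow> e \<noteq> {}"
    and size: "\<And>e. e \<in> E \<Longrightarrow> m \<le> card e"
    and deg: "\<And>e. e \<in> E \<Longrightarrow> 8 * card {f \<in> E. f \<inter> e \<noteq> {}} \<le> 2 ^ m"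
  shows "F \<subseteq> E \<Longrightarrow> e \<in> E \<Longrightarrow>
    2 ^ m * card {A \<in> colourings W F. \<not> bichromatic A e} \<le> 4 * card (colourings W F)"
proof (induction "card F" arbitrary: F e rule: less_induct)
  case less
  let ?mono = "\<lambda>G e. {A \<in> colourings W G. \<not> bichromatic A e}"
  have finE: "finite E"
    using E W by (meson Pow_iff finite_Pow_iff finite_subset subsetI)
  then have finF: "finite F" using less.prems finite_subset by blast
  define F1 where "F1 = {f \<in> F. f \<inter> e \<noteq> {}}"
  define F2 where "F2 = F - F1"
  define g where "g = card (colourings W F)"
  define g2 where "g2 = card (colourings W F2)"
  have fin: "finite (colourings W G)" for G by (rule finite_colourings[OF W])
  have "?mono F e \<subseteq> ?mono F2 e" by (auto simp: colourings_def F2_def)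
  then have "2 ^ m * card (?mono F e) \<le> 2 ^ card e * card (?mono F2 e)"
    using size[OF less.prems(2)] fin by (intro mult_mono card_mono) auto
  also have "\<dots> = 2 * g2"
    unfolding g2_def using W E less.prems
    by (intro monochromatic_independent) (auto simp: F2_def F1_def)
  finally have a: "2 ^ m * card (?mono F e) \<le> 2 * g2" .
  \<comment> \<open>When \<open>F1\<close> is empty, \<open>F2\<close> is not smaller than \<open>F\<close> and the induction hypothesis is out of reach.\<close>
  have "g2 \<le> 2 * g"
  proof (cases "F1 = {}")
    case True
    then show ?thesis by (simp add: g_def g2_def F2_def)
  next
    case False
    have F1E: "F1 \<subseteq> {f \<in> E. f \<inter> e \<noteq> {}}" using less.prems by (auto simp: F1_def)
    have "card F1 \<le> card {f \<in> E. f \<inter> e \<noteq> {}}"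
      using F1E finE by (intro card_mono) auto
    then have d: "8 * card F1 \<le> 2 ^ m" using deg[OF less.prems(2)] by linarith
    have "card F2 < card F"
      using False finF by (intro psubset_card_mono) (auto simp: F2_def F1_def)
    then have IH: "2 ^ m * card (?mono F2 f) \<le> 4 * g2" if "f \<in> F1" for f
      unfolding g2_def using less.hyps[of F2 f] less.prems that by (auto simp: F2_def F1_def)
    have "colourings W F2 \<subseteq> colourings W F \<union> (\<Union>f\<in>F1. ?mono F2 f)"
      by (auto simp: colourings_def F2_def)
    then have "g2 \<le> card (colourings W F \<union> (\<Union>f\<in>F1. ?mono F2 f))"
      unfolding g2_def using fin finF by (intro card_mono) (auto simp: F1_def)
    also have "\<dots> \<le> g + (\<Sum>f\<in>F1. card (?mono F2 f))"
      unfolding g_def using finF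
      by (intro order.trans[OF card_Un_le] add_left_mono card_UN_le) (auto simp: F1_def)
    finally have "2 ^ m * g2 \<le> 2 ^ m * g + (\<Sum>f\<in>F1. 2 ^ m * card (?mono F2 f))"
      by (simp flip: sum_distrib_left distrib_left)
    also have "\<dots> \<le> 2 ^ m * g + card F1 * (4 * g2)"
      using sum_bounded_above[of F1 "\<lambda>f. 2 ^ m * card (?mono F2 f)" "4 * g2"] IH by simp
    finally have "2 * (2 ^ m * g2) \<le> 2 * (2 ^ m * g) + (8 * card F1) * g2" by simp
    also have "\<dots> \<le> 2 * (2 ^ m * g) + 2 ^ m * g2"
      using d by (intro add_left_mono mult_right_mono) auto
    finally have "2 ^ m * g2 \<le> 2 ^ m * (2 * g)" by simp
    then show ?thesis by simp
  qed
  with a show ?case by (simp add: g_def)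
qed

text \<open>
  Adding the edges one at a time, each step discards at most half of the colourings that are left.
\<close>

lemma finite_hypergraph_two_colourable:
  assumes W: "finite W" and E: "\<And>e. e \<in> E \<Longrightarrow> e \<subseteq> W" "\<And>e. e \<in> E \<Longrightarrow> e \<noteq> {}"
    and size: "\<And>e. e \<in> E \<Longrightarrow> m \<le> card e"
    and deg: "\<And>e. e \<in> E \<Longrightarrow> 8 * card {f \<in> E. f \<inter> e \<noteq> {}} \<le> 2 ^ m"
  shows "\<exists>A. \<forall>e\<in>E. bichromatic A e"
proof -
  have finE: "finite E"
    using E W by (meson Pow_iff finite_Pow_iff finite_subset subsetI)
  have "F \<subseteq> E \<Longrightarrow> card (colourings W F) > 0" if "finite F" for F
    using that
  proof induction
    case empty
    have "{} \<in> colourings W {}" by (simp add: colourings_def)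
    then show ?case using finite_colourings[OF W, of "{}"] card_gt_0_iff by blast
  next
    case (insert e F)
    then have "e \<in> E" by simp
    let ?mono = "{A \<in> colourings W F. \<not> bichromatic A e}"
    have "card {f \<in> E. f \<inter> e \<noteq> {}} > 0"
      using \<open>e \<in> E\<close> E finE by (auto simp: card_gt_0_iff)
    \<comment> \<open>The edge meets itself, so the degree bound forces \<open>m \<ge> 3\<close>.\<close>
    then have "8 \<le> (2::nat) ^ m" using deg[OF \<open>e \<in> E\<close>] by linarith
    then have "8 * card ?mono \<le> 2 ^ m * card ?mono" by (rule mult_right_mono) simp
    also have "\<dots> \<le> 4 * card (colourings W F)"
      using insert.prems by (intro monochromatic_conditional[OF W E size deg]) auto
    finally have less: "card ?mono < card (colourings W F)"
      using insert by simp
    have "colourings W (insert e F) = colourings W F - ?mono"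
      by (auto simp: colourings_def)
    moreover have "card (colourings W F - ?mono) = card (colourings W F) - card ?mono"
      using finite_colourings[OF W, of F] by (intro card_Diff_subset) auto
    ultimately show ?case using less by simp
  qed
  from this[OF finE] have "colourings W E \<noteq> {}" by (auto simp: card_gt_0_iff)
  then obtain A where "A \<in> colourings W E" by blast
  then show ?thesis unfolding colourings_def by blast
qed

text \<open>
  By Tychonoff's theorem the space of all colourings is compact, and for a finite edge the
  colourings that make it bichromatic form a closed set.
\<close>

lemma two_colouring_compactness:
  assumes fin: "\<And>e. e \<in> E \<Longrightarrow> finite e"
    and sub: "\<And>F. finite F \<Longrightarrow> F \<subseteq> E \<Longrightarrow> \<exists>A. \<forall>e\<in>F. bichromatic A e"
  shows "\<exists>A. \<forall>e\<in>E. bichromatic A e"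
proof -
  define X where "X = product_topology (\<lambda>_::'a. discrete_topology (UNIV :: bool set)) UNIV"
  have top: "topspace X = UNIV" by (simp add: X_def)
  have compact: "compact_space X"
    by (simp add: X_def compact_space_product_topology compact_space_discrete_topology)
  define Good where "Good e = {h. bichromatic (Collect h) e}" for e :: "'a set"
  have proj: "closedin X {h. h a = b}" for a b
  proof -
    have "continuous_map X (discrete_topology UNIV) (\<lambda>h. h a)"
      unfolding X_def by (rule continuous_map_product_projection) simp
    from closedin_continuous_map_preimage[OF this, of "{b}"] show ?thesis
      by (simp add: top)
  qed
  have closed: "closedin X (Good e)" if "e \<in> E" for e
  proof -
    have eq: "Good e = (\<Union>a\<in>e. {h. h a = True}) \<inter> (\<Union>a\<in>e. {h. h a = False})"
      by (auto simp: Good_def bichromatic_def)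
    have "closedin X (\<Union>a\<in>e. {h. h a = b})" for b
      using fin[OF that] proj by (intro closedin_Union) auto
    then show ?thesis unfolding eq by (intro closedin_Int)
  qed
  have fip: "\<Inter>\<F> \<noteq> {}" if F: "finite \<F>" "\<F> \<subseteq> Good ` E" for \<F>
  proof -
    obtain F where "F \<subseteq> E" "finite F" "\<F> = Good ` F"
      using finite_subset_image[OF F] by blast
    moreover from this obtain A where "\<forall>e\<in>F. bichromatic A e"
      using sub by blast
    ultimately have "(\<lambda>a. a \<in> A) \<in> \<Inter>\<F>" by (auto simp: Good_def)
    then show ?thesis by blast
  qed
  have "\<Inter>(Good ` E) \<noteq> {}"
    using compact[unfolded compact_space_fip, rule_format, of "Good ` E"] closed fip by blast
  then obtain h where "h \<in> \<Inter>(Good ` E)" by blast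
  then have "\<forall>e\<in>E. bichromatic (Collect h) e" by (simp add: Good_def)
  then show ?thesis by blast
qed

theorem hypergraph_two_colourable:
  assumes fin: "\<And>e. e \<in> E \<Longrightarrow> finite e" and ne: "\<And>e. e \<in> E \<Longrightarrow> e \<noteq> {}"
    and size: "\<And>e. e \<in> E \<Longrightarrow> m \<le> card e"
    and finite_deg: "\<And>e. e \<in> E \<Longrightarrow> finite {f \<in> E. f \<inter> e \<noteq> {}}"
    and deg: "\<And>e. e \<in> E \<Longrightarrow> 8 * card {f \<in> E. f \<inter> e \<noteq> {}} \<le> 2 ^ m"
  shows "\<exists>A. \<forall>e\<in>E. bichromatic A e"
proof (rule two_colouring_compactness)
  fix F assume F: "finite F" "F \<subseteq> E"
  have "8 * card {f \<in> F. f \<inter> e \<noteq> {}} \<le> 2 ^ m" if "e \<in> F" for e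
  proof -
    have "card {f \<in> F. f \<inter> e \<noteq> {}} \<le> card {f \<in> E. f \<inter> e \<noteq> {}}"
      using F that finite_deg by (intro card_mono) auto
    then show ?thesis using deg[of e] F that by auto
  qed
  note deg_F = this
  show "\<exists>A. \<forall>e\<in>F. bichromatic A e"
  proof (rule finite_hypergraph_two_colourable[of "\<Union>F" F m])
    show "finite (\<Union>F)" using F fin by blast
    show "e \<subseteq> \<Union>F" "e \<noteq> {}" "m \<le> card e" "8 * card {f \<in> F. f \<inter> e \<noteq> {}} \<le> 2 ^ m"
      if "e \<in> F" for e
      using that F ne[of e] size[of e] deg_F[of e] by auto
  qed
qed (rule fin)

section \<open>Vertices of an arrangement of unit spheres\<close>

definition near :: "'a::metric_space set \<Rightarrow> 'a \<Rightarrow> 'a set" where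
  "near C x = {a \<in> C. dist a x < 1}"

definition vertex :: "'a::euclidean_space set \<Rightarrow> 'a \<Rightarrow> bool" where
  "vertex T y \<longleftrightarrow> span ((\<lambda>a. a - y) ` {a \<in> T. dist a y = 1}) = UNIV"

text \<open>
  For a common point \<open>x\<close> of the spheres, every other common point \<open>x + u\<close> satisfies
  \<open>2 (u \<bullet> (a - x)) = u \<bullet> u\<close> for all centres \<open>a\<close>. If \<open>x + u\<close> and \<open>x + w\<close> are two such points, then
  \<open>(w \<bullet> w) u - (u \<bullet> u) w\<close> is orthogonal to all \<open>a - x\<close>, which span the space; hence it vanishes,
  and comparing norms gives \<open>u = w\<close>.
\<close>

lemma sphere_intersection_le_2:
  fixes T :: "'a::euclidean_space set"
  defines "V \<equiv> {y. (\<forall>a\<in>T. dist a y = 1) \<and> vertex T y}"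
  shows "finite V \<and> card V \<le> 2"
proof (rule ccontr)
  assume contra: "\<not> (finite V \<and> card V \<le> 2)"
  have "\<exists>Y\<subseteq>V. card Y = 3"
  proof (cases "finite V")
    case True
    with contra have "3 \<le> card V" by simp
    then show ?thesis by (metis obtain_subset_with_card_n)
  next
    case False
    then show ?thesis using infinite_arbitrarily_large by blast
  qed
  then obtain Y where Y: "Y \<subseteq> V" "card Y = 3" by blast
  obtain x y z where "Y = {x, y, z}" "x \<noteq> y" "y \<noteq> z" "x \<noteq> z"
    using Y(2) unfolding card_3_iff by blast
  with Y(1) have xyz: "x \<in> V" "y \<in> V" "z \<in> V" "y \<noteq> x" "z \<noteq> x" "y \<noteq> z" by auto
  define u where "u = y - x"
  define w where "w = z - x"
  have sphere: "2 * inner v (a - x) = inner v v" if "x + v \<in> V" "a \<in> T" for a v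
  proof -
    have "dist a x = 1" "dist a (x + v) = 1" using that xyz by (auto simp: V_def)
    then have "inner (a - x) (a - x) = 1" "inner (a - x - v) (a - x - v) = 1"
      by (simp_all add: dist_norm norm_eq_1 diff_diff_eq)
    then show ?thesis by (simp add: inner_diff inner_commute algebra_simps)
  qed
  have su: "2 * inner u (a - x) = inner u u" and sw: "2 * inner w (a - x) = inner w w"
    if "a \<in> T" for a
    using sphere[OF _ that] xyz by (auto simp: u_def w_def)
  define n where "n = inner w w *\<^sub>R u - inner u u *\<^sub>R w"
  have "inner n (a - x) = 0" if "a \<in> T" for a
  proof -
    have "2 * inner n (a - x) = inner w w * (2 * inner u (a - x)) - inner u u * (2 * inner w (a - x))"
      by (simp add: n_def inner_diff_left)
    then show ?thesis using su[OF that] sw[OF that] by simp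
  qed
  moreover have "span ((\<lambda>a. a - x) ` {a \<in> T. dist a x = 1}) = UNIV"
    using xyz by (simp add: V_def vertex_def)
  ultimately have "orthogonal n n"
    by (intro orthogonal_to_span[of n "(\<lambda>a. a - x) ` {a \<in> T. dist a x = 1}"])
      (auto simp: orthogonal_def)
  then have eq: "inner w w *\<^sub>R u = inner u u *\<^sub>R w" by (simp add: orthogonal_def n_def)
  have nz: "norm u \<noteq> 0" "norm w \<noteq> 0" using xyz by (auto simp: u_def w_def)
  have "norm (inner w w *\<^sub>R u) = norm (inner u u *\<^sub>R w)" using eq by simp
  then have "norm w * (norm w * norm u) = norm u * (norm w * norm u)"
    by (simp add: dot_square_norm power2_eq_square mult_ac)
  then have "norm w = norm u" using nz by simp
  then have "u = w" using eq nz by (simp add: dot_square_norm)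
  then show False using xyz by (simp add: u_def w_def)
qed

lemma vertex_of_DIM_centres:
  fixes y :: "'a::euclidean_space"
  assumes "vertex C y"
  obtains T where "T \<subseteq> {a \<in> C. dist a y = 1}" "card T = DIM('a)" "vertex T y"
proof -
  let ?Q = "(\<lambda>a. a - y) ` {a \<in> C. dist a y = 1}"
  obtain B where B: "B \<subseteq> ?Q" "independent B" "?Q \<subseteq> span B" "card B = dim ?Q"
    by (rule basis_exists)
  have spanQ: "span ?Q = UNIV" using assms by (simp add: vertex_def)
  then have "span B = UNIV" using span_minimal[OF B(3) subspace_span] by auto
  have "dim ?Q = DIM('a)" using spanQ dim_span[of ?Q] by (simp del: dim_span)
  define T where "T = (\<lambda>b. b + y) ` B"
  have T: "T \<subseteq> {a \<in> C. dist a y = 1}" using B by (auto simp: T_def)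
  have "card T = DIM('a)"
    using B \<open>dim ?Q = DIM('a)\<close> by (simp add: T_def card_image)
  moreover have "{a \<in> T. dist a y = 1} = T" using T by auto
  then have "vertex T y" using \<open>span B = UNIV\<close> by (simp add: vertex_def T_def image_image)
  ultimately show ?thesis using that T by blast
qed

lemma card_vertices_le:
  fixes P :: "'a::euclidean_space set"
  assumes "finite P"
  defines "V \<equiv> {y. vertex P y}"
  shows "finite V \<and> card V \<le> 2 * card P ^ DIM('a)"
proof -
  let ?I = "{T. T \<subseteq> P \<and> card T = DIM('a)}"
  let ?sol = "\<lambda>T. {y. (\<forall>a\<in>T. dist a y = 1) \<and> vertex T y}"
  have finI: "finite ?I" using assms by simp
  have "V \<subseteq> (\<Union>T\<in>?I. ?sol T)"
  proof
    fix y assume "y \<in> V"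
    then obtain T where "T \<subseteq> {a \<in> P. dist a y = 1}" "card T = DIM('a)" "vertex T y"
      using vertex_of_DIM_centres[of P y] by (auto simp: V_def)
    then show "y \<in> (\<Union>T\<in>?I. ?sol T)" by blast
  qed
  moreover have fin: "finite (\<Union>T\<in>?I. ?sol T)"
    using finI sphere_intersection_le_2 by blast
  ultimately have "finite V" and "card V \<le> card (\<Union>T\<in>?I. ?sol T)"
    by (auto intro: finite_subset card_mono)
  note this(2)
  also have "card (\<Union>T\<in>?I. ?sol T) \<le> (\<Sum>T\<in>?I. card (?sol T))"
    by (rule card_UN_le[OF finI])
  also have "\<dots> \<le> card ?I * 2"
    using sum_bounded_above[of ?I "\<lambda>T. card (?sol T)" 2] sphere_intersection_le_2 by auto
  also have "card ?I = card P choose DIM('a)" by (rule n_subsets[OF assms(1)])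
  also have "\<dots> \<le> card P ^ DIM('a)"
    by (cases "DIM('a) \<le> card P") (auto intro: binomial_le_pow simp: binomial_eq_0)
  finally have "card V \<le> 2 * card P ^ DIM('a)" by (simp only: mult.commute)
  with \<open>finite V\<close> show ?thesis by (rule conjI)
qed

lemma vertex_local:
  assumes "vertex C y" "cball y 1 \<subseteq> D"
  shows "vertex (C \<inter> D) y"
proof -
  have "{a \<in> C \<inter> D. dist a y = 1} = {a \<in> C. dist a y = 1}"
    using assms(2) by (auto simp: subset_iff dist_commute)
  then show ?thesis using assms(1) by (simp add: vertex_def)
qed

text \<open>
  The points whose set of near centres lies in that of \<open>x\<close> form a set \<open>K\<close> obtained by removing open
  balls. Every point has a near centre, so \<open>K\<close> is bounded and has a point \<open>y\<close> of maximal norm. If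
  \<open>y\<close> were not a vertex, some nonzero \<open>v\<close> would be orthogonal to the directions from \<open>y\<close> to all
  centres at distance 1. A short move along \<open>v\<close> or \<open>- v\<close> increases the distance to those centres and
  reaches no other removed ball, hence stays in \<open>K\<close>. For one of the two signs it also increases the
  norm, which is a contradiction.
\<close>

lemma near_contains_near_vertex:
  fixes C :: "'a::euclidean_space set"
  assumes loc: "\<And>z. finite (C \<inter> cball z 2)" and cov: "\<And>z. near C z \<noteq> {}"
  obtains y where "vertex C y" "near C y \<subseteq> near C x"
proof -
  define U where "U = C - near C x"
  define K where "K = {z. \<forall>a\<in>U. dist a z \<ge> 1}"
  have K: "z \<in> K \<longleftrightarrow> near C z \<subseteq> near C x" for z
    by (auto simp: K_def U_def near_def simp flip: not_less)
  have "closed K"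
  proof -
    have "K = (\<Inter>a\<in>U. - ball a 1)" by (auto simp: K_def not_less)
    then show ?thesis by auto
  qed
  moreover have "bounded K"
  proof (rule bounded_subset[of "cball x 2"])
    show "K \<subseteq> cball x 2"
    proof
      fix z assume "z \<in> K"
      then obtain a where "dist a z < 1" "dist a x < 1"
        using cov[of z] K[of z] by (auto simp: near_def)
      then show "z \<in> cball x 2" by metric
    qed
  qed simp
  ultimately have "compact K" by (simp add: compact_eq_bounded_closed)
  moreover have "x \<in> K" by (simp add: K)
  ultimately obtain y where y: "y \<in> K" "\<And>z. z \<in> K \<Longrightarrow> norm z \<le> norm y"
    using continuous_attains_sup[of K norm] by (auto intro: continuous_intros)
  have "span ((\<lambda>a. a - y) ` {a \<in> C. dist a y = 1}) = UNIV"
  proof (rule ccontr)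
    assume "\<not> ?thesis"
    then obtain v0 where "v0 \<noteq> 0" "\<forall>q\<in>span ((\<lambda>a. a - y) ` {a \<in> C. dist a y = 1}). inner v0 q = 0"
      using span_not_univ_subset_hyperplane[of "(\<lambda>a. a - y) ` {a \<in> C. dist a y = 1}"] by blast
    then have v0: "v0 \<noteq> 0" "\<And>a. a \<in> C \<Longrightarrow> dist a y = 1 \<Longrightarrow> inner v0 (a - y) = 0"
      by (auto intro: span_base)
    define v where "v = (if inner y v0 \<ge> 0 then v0 else - v0)"
    have v: "v \<noteq> 0" "inner y v \<ge> 0" "\<And>a. a \<in> C \<Longrightarrow> dist a y = 1 \<Longrightarrow> inner v (a - y) = 0"
      using v0 by (auto simp: v_def)
    \<comment> \<open>The finitely many centres in \<open>?G\<close> leave a gap; farther ones are safe for moves up to length 1.\<close>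
    let ?G = "{a \<in> U. dist a y > 1 \<and> dist a y \<le> 2}"
    have "finite ?G"
      using loc[of y] by (rule rev_finite_subset) (auto simp: U_def dist_commute)
    then obtain \<epsilon> where \<epsilon>: "\<epsilon> > 0" "\<epsilon> \<le> 1" "\<And>a. a \<in> ?G \<Longrightarrow> \<epsilon> \<le> dist a y - 1"
    proof -
      let ?D = "insert 1 ((\<lambda>a. dist a y - 1) ` ?G)"
      have "finite ?D" using \<open>finite ?G\<close> by simp
      then show thesis
        by (intro that[of "Min ?D"]) (auto simp: Min_gr_iff intro: Min_le)
    qed
    define t where "t = \<epsilon> / norm v"
    have t: "t > 0" "norm (t *\<^sub>R v) = \<epsilon>" using \<epsilon> v by (auto simp: t_def)
    have "y + t *\<^sub>R v \<in> K"
      unfolding K_def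
    proof (intro CollectI ballI)
      fix a assume a: "a \<in> U"
      have tri: "dist a y \<le> dist a (y + t *\<^sub>R v) + \<epsilon>"
        using dist_triangle[of a y "y + t *\<^sub>R v"] t(2) by (simp add: dist_norm)
      have "dist a y \<ge> 1" using y(1) a by (simp add: K_def)
      then consider "dist a y = 1" | "dist a y > 1" "dist a y \<le> 2" | "dist a y > 2" by linarith
      then show "1 \<le> dist a (y + t *\<^sub>R v)"
      proof cases
        case 1
        then have "inner v (a - y) = 0" using v a by (auto simp: U_def)
        then have "orthogonal (a - y) (- (t *\<^sub>R v))"
          by (simp add: orthogonal_def inner_commute)
        from norm_add_Pythagorean[OF this]
        have "(norm (a - y - t *\<^sub>R v))\<^sup>2 = (norm (a - y))\<^sup>2 + (norm (t *\<^sub>R v))\<^sup>2" by simp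
        moreover have "norm (a - y) = 1" using 1 by (simp add: dist_norm)
        ultimately have "1\<^sup>2 \<le> (norm (a - (y + t *\<^sub>R v)))\<^sup>2" by (simp add: diff_diff_eq)
        then show ?thesis unfolding dist_norm by (rule power2_le_imp_le) simp
      next
        case 2
        then show ?thesis using \<epsilon>(3)[of a] a tri by auto
      next
        case 3
        then show ?thesis using \<epsilon>(2) tri by linarith
      qed
    qed
    then have "(norm (y + t *\<^sub>R v))\<^sup>2 \<le> (norm y)\<^sup>2" using y(2) by (intro power_mono) auto
    moreover have "(norm (y + t *\<^sub>R v))\<^sup>2 = (norm y)\<^sup>2 + 2 * t * inner y v + \<epsilon>\<^sup>2"
      unfolding t(2)[symmetric] power2_norm_eq_inner
      by (simp add: inner_add inner_commute algebra_simps power2_eq_square)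
    moreover have "2 * t * inner y v \<ge> 0" using t(1) v(2) by simp
    ultimately show False using \<epsilon>(1) by (smt (verit) zero_less_power)
  qed
  then show ?thesis using that y(1) K by (simp add: vertex_def)
qed

section \<open>Splitting coverings by unit balls\<close>

lemma obtain_unit_ball_cover:
  obtains Z :: "'a::euclidean_space set" where "finite Z" "cball 0 3 \<subseteq> (\<Union>z\<in>Z. ball z 1)"
proof -
  have "cball (0::'a) 3 \<subseteq> (\<Union>z\<in>UNIV. ball z 1)"
    by (meson UN_I UNIV_I centre_in_ball subsetI zero_less_one)
  then obtain Z where "Z \<subseteq> (UNIV :: 'a set)" "finite Z" "cball (0::'a) 3 \<subseteq> (\<Union>z\<in>Z. ball z 1)"
    by (rule compactE_image[OF compact_cball, rotated]) auto
  then show ?thesis using that by blast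
qed

lemma card_cball_3_le:
  fixes C Z :: "'a::euclidean_space set" and b :: real
  assumes Z: "finite Z" "cball 0 3 \<subseteq> (\<Union>z\<in>Z. ball z 1)"
    and near: "\<And>x. finite (near C x)" "\<And>x. real (card (near C x)) \<le> b"
  shows "finite (C \<inter> cball x 3) \<and> real (card (C \<inter> cball x 3)) \<le> card Z * b"
proof -
  have sub: "C \<inter> cball x 3 \<subseteq> (\<Union>z\<in>Z. near C (x + z))"
  proof
    fix a assume a: "a \<in> C \<inter> cball x 3"
    then have "a - x \<in> cball 0 3" by (simp add: dist_norm norm_minus_commute)
    then obtain z where "z \<in> Z" "dist z (a - x) < 1" using Z by auto
    then have "a \<in> near C (x + z)"
      using a by (simp add: near_def dist_norm norm_minus_commute algebra_simps)
    then show "a \<in> (\<Union>z\<in>Z. near C (x + z))" using \<open>z \<in> Z\<close> by blast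
  qed
  have fin: "finite (\<Union>z\<in>Z. near C (x + z))" using Z near by blast
  have "card (C \<inter> cball x 3) \<le> (\<Sum>z\<in>Z. card (near C (x + z)))"
    using card_mono[OF fin sub] card_UN_le[OF Z(1)] by (rule order.trans)
  then have "real (card (C \<inter> cball x 3)) \<le> (\<Sum>z\<in>Z. real (card (near C (x + z))))"
    by (simp flip: of_nat_sum)
  also have "\<dots> \<le> card Z * b" using near by (intro sum_bounded_above) auto
  finally show ?thesis using finite_subset[OF sub fin] by simp
qed

text \<open>
  The hypergraph lemma is applied to the sets of near centres of the vertices only: every other point
  then sees both colours because its set of near centres contains one of these.
\<close>

lemma centres_two_colourable:
  fixes C Z :: "'a::euclidean_space set" and m :: nat and b :: real
  assumes Z: "finite Z" "cball (0::'a) 3 \<subseteq> (\<Union>z\<in>Z. ball z 1)"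
    and "m \<ge> 1"
    and cov: "\<And>x. m \<le> card (near C x)"
    and near: "\<And>x. finite (near C x)" "\<And>x. real (card (near C x)) \<le> b"
    and b: "16 * (card Z * b) ^ DIM('a) \<le> 2 ^ m"
  shows "\<exists>A. \<forall>x. bichromatic A (near C x)"
proof -
  note loc = card_cball_3_le[OF Z near]
  have ne: "near C x \<noteq> {}" for x using cov[of x] \<open>m \<ge> 1\<close> by auto
  define E where "E = near C ` {y. vertex C y}"
  have deg: "finite {f \<in> E. f \<inter> near C y \<noteq> {}} \<and> 8 * card {f \<in> E. f \<inter> near C y \<noteq> {}} \<le> 2 ^ m" for y
  proof -
    let ?P = "C \<inter> cball y 3"
    let ?V = "{z. vertex ?P z}"
    note V = card_vertices_le[OF conjunct1[OF loc[of y]]]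
    have sub: "{f \<in> E. f \<inter> near C y \<noteq> {}} \<subseteq> near C ` ?V"
    proof clarify
      fix f assume "f \<in> E" and int: "f \<inter> near C y \<noteq> {}"
      then obtain z where z: "vertex C z" "f = near C z" by (auto simp: E_def)
      obtain a where "dist a z < 1" "dist a y < 1" using int z by (auto simp: near_def)
      then have "dist y z < 2" by metric
      then have "cball z 1 \<subseteq> cball y 3" by (simp add: cball_subset_cball_iff dist_commute)
      then show "f \<in> near C ` ?V" using vertex_local z by blast
    qed
    have "card {f \<in> E. f \<inter> near C y \<noteq> {}} \<le> 2 * card ?P ^ DIM('a)"
      using V card_mono[OF _ sub] card_image_le[of ?V "near C"] by fastforce
    then have "real (8 * card {f \<in> E. f \<inter> near C y \<noteq> {}}) \<le> 16 * real (card ?P) ^ DIM('a)"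
      by (simp flip: of_nat_power)
    also have "\<dots> \<le> 16 * (card Z * b) ^ DIM('a)"
      using loc[of y] by (intro mult_left_mono power_mono) auto
    also have "\<dots> \<le> 2 ^ m" by (rule b)
    finally have "8 * card {f \<in> E. f \<inter> near C y \<noteq> {}} \<le> 2 ^ m"
      by (simp flip: of_nat_le_iff[where 'a = real])
    then show ?thesis using sub V finite_subset by blast
  qed
  have "\<exists>A. \<forall>e\<in>E. bichromatic A e"
  proof (rule hypergraph_two_colourable[of E m])
    show "finite {f \<in> E. f \<inter> e \<noteq> {}}" "8 * card {f \<in> E. f \<inter> e \<noteq> {}} \<le> 2 ^ m"
      if "e \<in> E" for e
      using that deg unfolding E_def by blast+
  qed (use near ne cov in \<open>auto simp: E_def\<close>)
  then obtain A where A: "\<forall>e\<in>E. bichromatic A e" by blast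
  have "bichromatic A (near C x)" for x
  proof -
    have "finite (C \<inter> cball z 2)" for z
      using loc[of z] by (rule conjunct1[THEN rev_finite_subset]) auto
    then obtain y where "vertex C y" "near C y \<subseteq> near C x"
      using near_contains_near_vertex[of C x] ne by blast
    then show ?thesis using A by (auto simp: E_def bichromatic_def)
  qed
  then show ?thesis by blast
qed

lemma unit_ball_inj: "inj (\<lambda>a::'a::euclidean_space. ball a 1)"
  by (auto intro!: injI simp: ball_eq_ball_iff)

theorem theorem5:
  assumes "CARD('n::finite) \<ge> 2"
  shows "\<exists>c::real. c > 0 \<and>
    (\<forall>m::nat. m \<ge> 1 \<longrightarrow>
      (\<forall>\<C> :: (real ^ 'n) set set.
         \<C> \<subseteq> open_unit_balls \<longrightarrow>
         fold_covering m \<C> \<longrightarrow>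
         covered_at_most (c * 2 powr (real m / real CARD('n))) \<C> \<longrightarrow>
         splits_into_two_coverings \<C>))"
proof -
  obtain Z :: "(real ^ 'n) set" where Z: "finite Z" "cball 0 3 \<subseteq> (\<Union>z\<in>Z. ball z 1)"
    by (rule obtain_unit_ball_cover)
  define c where "c = 1 / (16 * real (card Z))"
  have "Z \<noteq> {}" using Z(2) by auto
  then have Zpos: "card Z > 0" using Z(1) by (simp add: card_gt_0_iff)
  have "splits_into_two_coverings \<C>"
    if m: "m \<ge> 1" and C: "\<C> \<subseteq> open_unit_balls" "fold_covering m \<C>"
      "covered_at_most (c * 2 powr (real m / real CARD('n))) \<C>"
    for m :: nat and \<C> :: "(real ^ 'n) set set"
  proof -
    let ?b = "c * 2 powr (real m / real CARD('n))"
    let ?B = "\<lambda>a :: real ^ 'n. ball a 1"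
    define C where "C = {a. ?B a \<in> \<C>}"
    have CC: "\<C> = ?B ` C" using C(1) by (auto simp: C_def open_unit_balls_def)
    have mem: "{B \<in> ?B ` D. x \<in> B} = ?B ` near D x" for D x
      unfolding near_def mem_ball[symmetric] by blast
    have inj: "inj_on ?B D" for D
      by (rule inj_on_subset[OF unit_ball_inj subset_UNIV])
    have card: "card {B \<in> \<C>. x \<in> B} = card (near C x)" for x
      unfolding CC mem by (rule card_image[OF inj])
    have finite: "finite {B \<in> \<C>. x \<in> B} \<longleftrightarrow> finite (near C x)" for x
      unfolding CC mem by (rule finite_image_iff[OF inj])
    have near: "finite (near C x)" "real (card (near C x)) \<le> ?b" for x
      using C(3) by (auto simp: covered_at_most_def card finite)
    have cov: "m \<le> card (near C x)" for x
      using C(2) near by (auto simp: fold_covering_def card finite)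
    have "(card Z * ?b) ^ DIM(real ^ 'n) = (2 powr (real m / real CARD('n)) / 16) ^ CARD('n)"
      using Zpos by (simp add: c_def)
    also have "\<dots> = 2 ^ m / 16 ^ CARD('n)"
      by (simp add: power_divide powr_realpow powr_powr flip: powr_realpow)
    also have "\<dots> \<le> 2 ^ m / 16 ^ 1"
      using assms by (intro divide_left_mono power_increasing) auto
    finally have b: "16 * (card Z * ?b) ^ DIM(real ^ 'n) \<le> 2 ^ m" by simp
    obtain A where A: "\<And>x. bichromatic A (near C x)"
      using centres_two_colourable[OF Z m cov near b] by blast
    have covering: "covering (?B ` D)" if "\<And>x. near D x \<noteq> {}" for D
    proof -
      have "card (?B ` near D x) \<ge> 1" if "finite (?B ` near D x)" for x
        using that \<open>near D x \<noteq> {}\<close> by (simp add: Suc_le_eq card_gt_0_iff)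
      then show ?thesis unfolding fold_covering_def mem by blast
    qed
    have "near (C \<inter> A) x \<noteq> {}" "near (C - A) x \<noteq> {}" for x
      using A[of x] by (auto simp: bichromatic_def near_def)
    then have "covering (?B ` (C \<inter> A)) \<and> covering (?B ` (C - A))"
      by (intro conjI covering)
    moreover have "?B ` (C \<inter> A) \<union> ?B ` (C - A) = \<C>" by (auto simp: CC)
    moreover have "?B ` (C \<inter> A) \<inter> ?B ` (C - A) = {}"
      using unit_ball_inj by (auto dest: injD)
    ultimately show ?thesis unfolding splits_into_two_coverings_def by blast
  qed
  moreover have "c > 0" using Zpos by (simp add: c_def)
  ultimately show ?thesis by blast
qed

end
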